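(* Let $\gamma:\mathbb{R}^d\to\mathbb{R}$ be a gauge. The following statements are equivalent: (a) The gauge $\gamma$ is a norm induced by an inner product. (b) Isosceles orthogonality is right homogeneous: for all $x,y\in\mathbb{R}^d$ and $\lambda>0$, $x\perp_I y$ implies $x\perp_I\lambda y$. (c) Isosceles orthogonality is right additive: for all $x,y,z\in\mathbb{R}^d$, $x\perp_I y$ and $x\perp_I z$ together imply $x\perp_I(y+z)$. (d) Isosceles orthogonality is left homogeneous: for all $x,y\in\mathbb{R}^d$ and $\lambda>0$, $x\perp_I y$ implies $\lambda x\perp_I y$. (e) Isosceles orthogonality is left additive: for all $x,y,z\in\mathbb{R}^d$, $x\perp_I z$ and $y\perp_I z$ together imply $(x+y)\perp_I z$.
   Context: A gauge is a function $\gamma:\mathbb{R}^d\to\mathbb{R}$ such that $\gamma(x)\geq 0$ for all $x$, $\gamma(x)=0$ implies $x=0$, $\gamma(\lambda x)=\lambda\gamma(x)$ for all $\lambda>0$, and $\gamma(x+y)\leq\gamma(x)+\gamma(y)$ (it need not be symmetric). A point $y\in\mathbb{R}^d$ is isosceles orthogonal to $x\in\mathbb{R}^d$, written $y\perp_I x$, if $\gamma(y+x)=\gamma(y-x)$. *)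

theory Defs
  imports "HOL-Analysis.Analysis"
begin

definition gauge_fun :: "(real ^ 'd \<Rightarrow> real) \<Rightarrow> bool" where
  "gauge_fun \<gamma> \<longleftrightarrow>
     (\<forall>x. \<gamma> x \<ge> 0) \<and>
     (\<forall>x. \<gamma> x = 0 \<longrightarrow> x = 0) \<and>
     (\<forall>x. \<forall>c>0. \<gamma> (c *\<^sub>R x) = c * \<gamma> x) \<and>
     (\<forall>x y. \<gamma> (x + y) \<le> \<gamma> x + \<gamma> y)"

text \<open>\<open>isosceles_orthogonal \<gamma> y x\<close> renders $y \perp_I x$. As \<open>\<gamma>\<close> need not be symmetric,
  the order of the two arguments matters.\<close>

definition isosceles_orthogonal ::
    "(real ^ 'd \<Rightarrow> real) \<Rightarrow> real ^ 'd \<Rightarrow> real ^ 'd \<Rightarrow> bool" where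
  "isosceles_orthogonal \<gamma> y x \<longleftrightarrow> \<gamma> (y + x) = \<gamma> (y - x)"

text \<open>An arbitrary inner product, not only the standard one of the class \<open>real_inner\<close>.\<close>

definition inner_product :: "(real ^ 'd \<Rightarrow> real ^ 'd \<Rightarrow> real) \<Rightarrow> bool" where
  "inner_product B \<longleftrightarrow>
     bilinear B \<and> (\<forall>x y. B x y = B y x) \<and> (\<forall>x. x \<noteq> 0 \<longrightarrow> B x x > 0)"

definition norm_induced_by_inner_product :: "(real ^ 'd \<Rightarrow> real) \<Rightarrow> bool" where
  "norm_induced_by_inner_product \<gamma> \<longleftrightarrow>
     (\<exists>B. inner_product B \<and> (\<forall>x. \<gamma> x = sqrt (B x x)))"

end

theory Submission
  imports Defs
begin

text \<open>
  Each of the four conditions forces \<open>\<gamma>\<close> to be symmetric: some multiple \<open>t z\<close> with \<open>\<bar>t\<bar> < 1\<close> is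
  isosceles orthogonal to \<open>z\<close>, and then so are the multiples \<open>n t z\<close> (or \<open>(t / 2) z\<close>, if
  orthogonality is right additive), which is only possible for \<open>t = 0\<close>. Hence \<open>\<gamma>\<close> is a norm,
  orthogonality is symmetric, and all conditions reduce to its homogeneity, additivity giving
  rational multiples and continuity the real ones. In a norm with this property, swapping two
  vectors of equal length is an isometry
  of their plane. Choose unit vectors \<open>x \<bottom> y\<close>. If \<open>a x + b y\<close> is a unit vector too, then
  composing the swap of \<open>x\<close> and \<open>a x + b y\<close> with the quarter turn \<open>x \<mapsto> y \<mapsto> - x\<close> gives an isometry
  of determinant \<open>-1\<close>; its trace must vanish, for otherwise it has a real eigenvalue of modulus
  different from 1, and this says \<open>a\<^sup>2 + b\<^sup>2 = 1\<close>. So every plane is Euclidean, and the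
  Jordan--von Neumann construction yields the inner product.
\<close>

section \<open>Norms with homogeneous isosceles orthogonality: every plane is Euclidean\<close>

locale homogeneous_isosceles_norm =
  fixes N :: "'a::real_normed_vector \<Rightarrow> real"
  assumes zero_imp: "N x = 0 \<Longrightarrow> x = 0"
    and scale: "N (c *\<^sub>R x) = \<bar>c\<bar> * N x"
    and nonneg: "N x \<ge> 0"
    and cont: "continuous_on UNIV N"
    and homog: "N (x + y) = N (x - y) \<Longrightarrow> c > 0 \<Longrightarrow> N (x + c *\<^sub>R y) = N (x - c *\<^sub>R y)"
begin

lemma zero: "N 0 = 0"
  using scale[of 0 0] by simp

lemma neg: "N (- x) = N x"
  using scale[of "-1" x] by simp

lemma minus_commute: "N (x - y) = N (y - x)"
  using neg[of "x - y"] by simp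

text \<open>Homogeneity covers a positive ratio \<open>q / p\<close>, exchanging the two sides a
  negative one, and the factor \<open>p\<close> is pulled out of the norm.\<close>

lemma reflect:
  assumes "N (x + y) = N (x - y)"
  shows "N (p *\<^sub>R x + q *\<^sub>R y) = N (p *\<^sub>R x - q *\<^sub>R y)"
proof (cases "p = 0")
  case True
  then show ?thesis using neg[of "q *\<^sub>R y"] by simp
next
  case False
  have r: "N (x + r *\<^sub>R y) = N (x - r *\<^sub>R y)" for r
  proof -
    consider "r > 0" | "r = 0" | "- r > 0" by linarith
    then show ?thesis
    proof cases
      case 1
      then show ?thesis using homog[OF assms] by simp
    next
      case 2
      then show ?thesis by simp
    next
      case 3
      then show ?thesis using homog[OF assms 3] by simp
    qed
  qed
  have "p *\<^sub>R x + q *\<^sub>R y = p *\<^sub>R (x + (q / p) *\<^sub>R y)"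
    "p *\<^sub>R x - q *\<^sub>R y = p *\<^sub>R (x - (q / p) *\<^sub>R y)"
    using False by (simp_all add: algebra_simps)
  then show ?thesis using r by (simp add: scale)
qed

text \<open>Half the sum and half the difference of two vectors of equal length are orthogonal, and
  the swap is the reflection that fixes the former and negates the latter.\<close>

lemma swap:
  assumes "N x = N y"
  shows "N (a *\<^sub>R x + b *\<^sub>R y) = N (b *\<^sub>R x + a *\<^sub>R y)"
proof -
  define u v where "u = (1/2) *\<^sub>R (x + y)" and "v = (1/2) *\<^sub>R (x - y)"
  have xy: "x = u + v" "y = u - v"
    by (simp_all add: u_def v_def algebra_simps flip: scaleR_add_left)
  have "N ((a + b) *\<^sub>R u + (a - b) *\<^sub>R v) = N ((a + b) *\<^sub>R u - (a - b) *\<^sub>R v)"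
    using assms by (intro reflect) (simp add: xy)
  then show ?thesis by (simp add: xy algebra_simps)
qed

lemma unit_circle:
  assumes x: "N x = 1" and y: "N y = 1" and orth: "N (x + y) = N (x - y)"
    and p: "N (a *\<^sub>R x + b *\<^sub>R y) = 1"
  shows "a\<^sup>2 + b\<^sup>2 = 1"
proof (cases "b = 0")
  case True
  then have "\<bar>a\<bar> = 1" using p x by (simp add: scale)
  then show ?thesis using True by (simp add: abs_square_eq_1)
next
  case False
  define c where "c = (1 - a\<^sup>2) / b"
  \<comment> \<open>The quarter turn followed by the swap of \<open>x\<close> and \<open>a x + b y\<close> maps \<open>x\<close> to \<open>c x - a y\<close> and
    \<open>y\<close> to \<open>- a x - b y\<close>; below, \<open>v\<close> is its eigenvector for the eigenvalue \<open>l\<close>.\<close>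
  have W: "N ((\<alpha> * c - \<beta> * a) *\<^sub>R x - (\<alpha> * a + \<beta> * b) *\<^sub>R y) = N (\<alpha> *\<^sub>R x + \<beta> *\<^sub>R y)" for \<alpha> \<beta>
  proof -
    let ?p = "a *\<^sub>R x + b *\<^sub>R y"
    \<comment> \<open>The quarter turn yields \<alpha> y - \<beta> x, whose coordinates with respect
      to \<open>x\<close> and \<open>?p\<close> are \<open>?r\<close> and \<alpha> / b; the swap
      exchanges these two.\<close>
    let ?r = "- (\<alpha> * a / b) - \<beta>"
    have c: "\<alpha> / b + ?r * a = \<alpha> * c - \<beta> * a" "?r * b = - (\<alpha> * a + \<beta> * b)"
      using False by (simp_all add: c_def field_simps power2_eq_square)
    have "N (\<alpha> *\<^sub>R x + \<beta> *\<^sub>R y) = N (\<beta> *\<^sub>R x + \<alpha> *\<^sub>R y)"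
      using swap x y by simp
    also have "\<dots> = N (\<beta> *\<^sub>R x - \<alpha> *\<^sub>R y)" by (rule reflect[OF orth])
    also have "\<dots> = N (\<alpha> *\<^sub>R y - \<beta> *\<^sub>R x)" by (rule minus_commute)
    also have "\<alpha> *\<^sub>R y - \<beta> *\<^sub>R x = ?r *\<^sub>R x + (\<alpha> / b) *\<^sub>R ?p"
      using False by (simp add: algebra_simps)
    also have "N \<dots> = N ((\<alpha> / b) *\<^sub>R x + ?r *\<^sub>R ?p)"
      using swap x p by simp
    also have "(\<alpha> / b) *\<^sub>R x + ?r *\<^sub>R ?p = (\<alpha> / b + ?r * a) *\<^sub>R x + (?r * b) *\<^sub>R y"
      by (simp only: scaleR_add_left scaleR_add_right scaleR_scaleR add.assoc)
    finally show ?thesis unfolding c scaleR_minus_left by simp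
  qed
  \<comment> \<open>The map has trace \<open>c - b\<close> and determinant - b c - a^2 = -1, so
    \<open>l\<close> is the positive root of its characteristic polynomial and
    \<open>- 1 / l\<close> is the other root.\<close>
  define l where "l = ((c - b) + sqrt ((c - b)\<^sup>2 + 4)) / 2"
  have "\<bar>c - b\<bar> < sqrt ((c - b)\<^sup>2 + 4)"
    by (rule real_less_rsqrt) simp
  then have l0: "l > 0" by (simp add: l_def)
  have "2 * l - (c - b) = sqrt ((c - b)\<^sup>2 + 4)" unfolding l_def by argo
  then have "(2 * l - (c - b))\<^sup>2 = (c - b)\<^sup>2 + 4" by simp
  then have l2: "l * l = (c - b) * l + 1"
    by (simp add: power2_eq_square algebra_simps)
  then have l: "c - b + 1 / l = l" using l0 by (simp add: field_simps)
  \<comment> \<open>By Cayley-Hamilton, adding \<open>1 / l\<close> times \<open>x\<close> to the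
    image of \<open>x\<close> gives a vector on which the map acts as \<open>l\<close>.\<close>
  define v where "v = (c + 1 / l) *\<^sub>R x - a *\<^sub>R y"
  have bc: "b * c = 1 - a\<^sup>2" using False by (simp add: c_def)
  have cl: "c + 1 / l = l + b" using l by linarith
  have e1: "(c + 1 / l) * c - (- a) * a = l * (c + 1 / l)"
  proof -
    have "(l + b) * c + a * a = l * c + 1" using bc by (simp add: algebra_simps power2_eq_square)
    also have "\<dots> = l * (c + 1 / l)" using l0 by (simp add: field_simps)
    finally show ?thesis by (simp add: cl)
  qed
  have e2: "(c + 1 / l) * a + (- a) * b = l * a"
    unfolding cl by (simp add: algebra_simps)
  have "N (l *\<^sub>R v) = N v"
    using W[of "c + 1 / l" "- a"] unfolding e1 e2 by (simp add: v_def scaleR_diff_right)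
  then have lv: "l * N v = N v" using l0 by (simp add: scale)
  \<comment> \<open>If \<open>v\<close> vanishes, then \<open>x\<close> is an eigenvector for
    \<open>- 1 / l\<close>; in both cases preservation of length forces modulus 1. The trace
    \<open>c - b\<close> is then 0.\<close>
  have "l = 1"
  proof (cases "v = 0")
    case True
    then have "c *\<^sub>R x - a *\<^sub>R y = (- (1 / l)) *\<^sub>R x"
      unfolding v_def by (simp add: algebra_simps add_eq_0_iff)
    then have "N ((- (1 / l)) *\<^sub>R x) = N x" using W[of 1 0] by simp
    then show ?thesis using x l0 unfolding scale by simp
  next
    case False
    then show ?thesis using lv zero_imp by auto
  qed
  then have "c = b" using l by simp
  then show ?thesis using bc by (simp add: power2_eq_square)
qed

text \<open>Dividing by the length reduces this to \<open>unit_circle\<close>. If the length is 0,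
  \<open>reflect\<close> makes both \<open>p x + q y\<close> and \<open>p x - q y\<close> vanish,
  hence \<open>p = q = 0\<close>.\<close>

lemma orthonormal:
  assumes x: "N x = 1" and y: "N y = 1" and orth: "N (x + y) = N (x - y)"
  shows "(N (p *\<^sub>R x + q *\<^sub>R y))\<^sup>2 = p\<^sup>2 + q\<^sup>2"
proof (cases "N (p *\<^sub>R x + q *\<^sub>R y) = 0")
  case True
  then have "p *\<^sub>R x + q *\<^sub>R y = 0" "p *\<^sub>R x - q *\<^sub>R y = 0"
    using reflect[OF orth, of p q] by (simp_all only: zero_imp)
  then have "p *\<^sub>R x + p *\<^sub>R x = 0" "p *\<^sub>R x = q *\<^sub>R y" by auto
  then have "p *\<^sub>R x = 0 \<and> q *\<^sub>R y = 0" by (simp flip: scaleR_2)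
  moreover have "x \<noteq> 0" "y \<noteq> 0" using x y zero by auto
  ultimately show ?thesis using True by simp
next
  case False
  define r where "r = N (p *\<^sub>R x + q *\<^sub>R y)"
  have r: "r > 0" using False nonneg by (simp add: r_def less_le)
  have "N ((1 / r) *\<^sub>R (p *\<^sub>R x + q *\<^sub>R y)) = 1"
    using r unfolding scale by (simp add: r_def)
  then have "N ((p / r) *\<^sub>R x + (q / r) *\<^sub>R y) = 1"
    by (simp add: scaleR_add_right)
  then have "(p / r)\<^sup>2 + (q / r)\<^sup>2 = 1" by (rule unit_circle[OF x y orth])
  then show ?thesis using r unfolding r_def[symmetric] by (simp add: field_simps)
qed

lemma exists_orthogonal:
  assumes "x \<noteq> 0"
  obtains t :: real and s where "s \<noteq> 0"
    "N (x + (t *\<^sub>R x + s *\<^sub>R w)) = N (x - (t *\<^sub>R x + s *\<^sub>R w))"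
proof -
  \<comment> \<open>A path from \<open>- x\<close> to \<open>x\<close> whose
    \<open>w\<close>-coefficient vanishes only at the ends. There \<open>g\<close> takes the values
    -2 N x and 2 N x, so its zero is interior and that coefficient can serve as
    \<open>s\<close>.\<close>
  define z where "z t = t *\<^sub>R x + (1 - t\<^sup>2) *\<^sub>R w" for t :: real
  define g where "g t = N (x + z t) - N (x - z t)" for t
  have "continuous_on {-1..1} g"
    unfolding g_def z_def
    by (intro continuous_intros continuous_on_compose2[OF cont]) auto
  moreover have "N x > 0" using assms zero_imp nonneg by (metis less_le)
  then have "g (-1) \<le> 0" "0 \<le> g 1"
    using scale[of 2 x] by (simp_all add: g_def z_def zero flip: scaleR_2)
  ultimately obtain t where t: "-1 \<le> t" "t \<le> 1" "g t = 0"
    using IVT'[of g "-1" 0 1] by auto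
  have "1 - t\<^sup>2 \<noteq> 0"
  proof
    assume "1 - t\<^sup>2 = 0"
    then have "t = 1 \<or> t = -1" by (simp add: power2_eq_1_iff)
    then show False using t(3) \<open>N x > 0\<close> scale[of 2 x]
      by (auto simp: g_def z_def zero simp flip: scaleR_2)
  qed
  then show thesis by (rule that) (use t(3) in \<open>simp add: g_def z_def\<close>)
qed

text \<open>In terms of a unit multiple \<open>x\<close> of \<open>u\<close> and a unit vector
  \<open>y\<close> orthogonal to it, the squared norm is a sum of squares of two linear forms in
  \<open>p\<close> and \<open>q\<close>. One square remains if \<open>w\<close> turns out to be a
  multiple of \<open>x\<close>.\<close>

lemma quadratic_on_plane:
  "\<exists>A B C. \<forall>p q. (N (p *\<^sub>R u + q *\<^sub>R w))\<^sup>2 = A * p\<^sup>2 + 2 * B * p * q + C * q\<^sup>2"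
proof (cases "u = 0")
  case True
  then have "\<forall>p q. (N (p *\<^sub>R u + q *\<^sub>R w))\<^sup>2 = 0 * p\<^sup>2 + 2 * 0 * p * q + (N w)\<^sup>2 * q\<^sup>2"
    by (simp add: scale power_mult_distrib)
  then show ?thesis by blast
next
  case False
  then have k: "N u > 0" using zero_imp nonneg by (metis less_le)
  define k where "k = N u"
  define x where "x = (1 / k) *\<^sub>R u"
  have x: "N x = 1" using k unfolding x_def k_def scale by simp
  have u: "u = k *\<^sub>R x" using k by (simp add: x_def k_def)
  have "x \<noteq> 0" using x zero by auto
  then obtain t s where s: "s \<noteq> 0"
    and o: "N (x + (t *\<^sub>R x + s *\<^sub>R w)) = N (x - (t *\<^sub>R x + s *\<^sub>R w))"
    using exists_orthogonal by blast
  define z where "z = t *\<^sub>R x + s *\<^sub>R w"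
  have w: "w = (- (t / s)) *\<^sub>R x + (1 / s) *\<^sub>R z"
    using s by (simp add: z_def algebra_simps)
  show ?thesis
  proof (cases "z = 0")
    case True
    have "p *\<^sub>R u + q *\<^sub>R w = (p * k - q * (t / s)) *\<^sub>R x" for p q
      unfolding u w True by (simp add: algebra_simps)
    then have "(N (p *\<^sub>R u + q *\<^sub>R w))\<^sup>2 = (p * k - q * (t / s))\<^sup>2" for p q
      by (simp add: scale x)
    then have "\<forall>p q. (N (p *\<^sub>R u + q *\<^sub>R w))\<^sup>2
        = k\<^sup>2 * p\<^sup>2 + 2 * (- k * (t / s)) * p * q + (t / s)\<^sup>2 * q\<^sup>2"
      by (simp add: power2_eq_square algebra_simps)
    then show ?thesis by blast
  next
    case False
    then have m: "N z > 0" using zero_imp nonneg by (metis less_le)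
    define m where "m = N z"
    define y where "y = (1 / m) *\<^sub>R z"
    have y: "N y = 1" using m unfolding y_def m_def scale by simp
    have z: "z = m *\<^sub>R y" using m by (simp add: y_def m_def)
    have orth: "N (x + y) = N (x - y)"
      using reflect[of x z 1 "1 / m"] o by (simp add: y_def z_def)
    have "p *\<^sub>R u + q *\<^sub>R w = (p * k - q * (t / s)) *\<^sub>R x + (q * (m / s)) *\<^sub>R y" for p q
      unfolding u w z by (simp add: algebra_simps)
    then have "(N (p *\<^sub>R u + q *\<^sub>R w))\<^sup>2 = (p * k - q * (t / s))\<^sup>2 + (q * (m / s))\<^sup>2" for p q
      by (simp add: orthonormal[OF x y orth])
    then have "\<forall>p q. (N (p *\<^sub>R u + q *\<^sub>R w))\<^sup>2
        = k\<^sup>2 * p\<^sup>2 + 2 * (- k * (t / s)) * p * q + ((t / s)\<^sup>2 + (m / s)\<^sup>2) * q\<^sup>2"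
      by (simp add: power2_eq_square algebra_simps)
    then show ?thesis by blast
  qed
qed

section \<open>The inner product obtained by polarization\<close>

definition polar :: "'a \<Rightarrow> 'a \<Rightarrow> real" where
  "polar x y = ((N (x + y))\<^sup>2 - (N (x - y))\<^sup>2) / 4"

lemma polar_commute: "polar x y = polar y x"
  by (simp add: polar_def add.commute minus_commute)

lemma polar_self: "polar x x = (N x)\<^sup>2"
  using scale[of 2 x] by (simp add: polar_def zero power_mult_distrib scaleR_2)

lemma parallelogram: "(N (x + y))\<^sup>2 + (N (x - y))\<^sup>2 = 2 * (N x)\<^sup>2 + 2 * (N y)\<^sup>2"
proof -
  obtain A B C where Q: "\<And>p q. (N (p *\<^sub>R x + q *\<^sub>R y))\<^sup>2 = A * p\<^sup>2 + 2 * B * p * q + C * q\<^sup>2"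
    using quadratic_on_plane by metis
  show ?thesis using Q[of 1 1] Q[of 1 "-1"] Q[of 1 0] Q[of 0 1] by simp
qed

text \<open>In the quadratic form on the plane of \<open>x\<close> and \<open>y\<close> both sides
  equal \<open>c * B\<close>, so all real factors are covered at once, without passing through
  rational ones.\<close>

lemma polar_scale: "polar (c *\<^sub>R x) y = c * polar x y"
proof -
  obtain A B C where Q: "\<And>p q. (N (p *\<^sub>R x + q *\<^sub>R y))\<^sup>2 = A * p\<^sup>2 + 2 * B * p * q + C * q\<^sup>2"
    using quadratic_on_plane by metis
  show ?thesis using Q[of c 1] Q[of c "-1"] Q[of 1 1] Q[of 1 "-1"] by (simp add: polar_def)
qed

lemma polar_add: "polar (u + v) w = polar u w + polar v w"
proof -
  \<comment> \<open>First plus third minus second minus fourth equation: the squares of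
    \<open>u + w - v\<close> and \<open>v + w - u\<close> cancel, as do those of \<open>u\<close>
    and \<open>v\<close>.\<close>
  have "(N (u + v + w))\<^sup>2 + (N (u + w - v))\<^sup>2 = 2 * (N (u + w))\<^sup>2 + 2 * (N v)\<^sup>2"
    "(N (u + v - w))\<^sup>2 + (N (v + w - u))\<^sup>2 = 2 * (N (u - w))\<^sup>2 + 2 * (N v)\<^sup>2"
    "(N (u + v + w))\<^sup>2 + (N (v + w - u))\<^sup>2 = 2 * (N (v + w))\<^sup>2 + 2 * (N u)\<^sup>2"
    "(N (u + v - w))\<^sup>2 + (N (u + w - v))\<^sup>2 = 2 * (N (v - w))\<^sup>2 + 2 * (N u)\<^sup>2"
    using parallelogram[of "u + w" v] parallelogram[of "u - w" v]
      parallelogram[of "v + w" u] parallelogram[of "v - w" u]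
      minus_commute[of "u + w" v] minus_commute[of "v + w" u]
    by (simp_all add: algebra_simps)
  then show ?thesis unfolding polar_def by argo
qed

lemma polar_bilinear: "bilinear polar"
  unfolding bilinear_def
proof safe
  show r: "linear (\<lambda>x. polar x y)" for y
    by (rule linearI) (simp_all add: polar_add polar_scale)
  show "linear (polar x)" for x
    using r[of x] unfolding polar_commute[of _ x] .
qed

lemma polar_pos: "x \<noteq> 0 \<Longrightarrow> polar x x > 0"
  using zero_imp by (auto simp: polar_self)

end

section \<open>Gauges: continuity, orthogonality along a line, and symmetry\<close>

lemma gauge_zero:
  assumes "gauge_fun \<gamma>"
  shows "\<gamma> 0 = 0"
proof -
  have "\<gamma> (2 *\<^sub>R 0) = 2 * \<gamma> 0" using assms zero_less_numeral unfolding gauge_fun_def by blast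
  then show ?thesis by simp
qed

text \<open>A sublinear function is convex, and a finite convex function on a finite-dimensional
  space is continuous.\<close>

lemma gauge_continuous:
  assumes "gauge_fun \<gamma>"
  shows "continuous_on UNIV \<gamma>"
proof -
  have le: "\<gamma> (c *\<^sub>R x) \<le> c * \<gamma> x" if "c \<ge> 0" for c x
    using assms that gauge_zero[OF assms] unfolding gauge_fun_def by (cases "c = 0") auto
  have "convex_on UNIV \<gamma>"
  proof (rule convex_onI)
    fix t :: real and x y
    assume "0 < t" "t < 1"
    have "\<gamma> ((1 - t) *\<^sub>R x + t *\<^sub>R y) \<le> \<gamma> ((1 - t) *\<^sub>R x) + \<gamma> (t *\<^sub>R y)"
      using assms unfolding gauge_fun_def by blast
    also have "\<dots> \<le> (1 - t) * \<gamma> x + t * \<gamma> y"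
      using \<open>0 < t\<close> \<open>t < 1\<close> by (intro add_mono le) auto
    finally show "\<gamma> ((1 - t) *\<^sub>R x + t *\<^sub>R y) \<le> (1 - t) * \<gamma> x + t * \<gamma> y" .
  qed simp
  then show ?thesis by (intro convex_on_continuous) auto
qed

text \<open>For these \<open>r\<close> the sum is a positive multiple of \<open>z\<close> and the
  difference one of \<open>- z\<close>. The case \<open>r = 0\<close> expresses symmetry at
  \<open>z\<close>.\<close>

lemma isosceles_orthogonal_multiple_iff:
  assumes g: "gauge_fun \<gamma>" and r: "\<bar>r\<bar> < 1"
  shows "isosceles_orthogonal \<gamma> (r *\<^sub>R z) z \<longleftrightarrow> (1 + r) * \<gamma> z = (1 - r) * \<gamma> (- z)"
proof -
  have sc: "\<gamma> (c *\<^sub>R x) = c * \<gamma> x" if "c > 0" for c x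
    using g that unfolding gauge_fun_def by blast
  have "r *\<^sub>R z + z = (1 + r) *\<^sub>R z" "r *\<^sub>R z - z = (1 - r) *\<^sub>R (- z)"
    by (simp_all add: algebra_simps)
  moreover have "1 + r > 0" "1 - r > 0" using r by auto
  ultimately show ?thesis by (simp add: isosceles_orthogonal_def sc del: scaleR_minus_right)
qed

lemma gauge_pos:
  assumes "gauge_fun \<gamma>" "x \<noteq> 0"
  shows "\<gamma> x > 0"
proof -
  have "\<gamma> x \<ge> 0" "\<gamma> x \<noteq> 0"
    using assms unfolding gauge_fun_def by blast+
  then show ?thesis by simp
qed

lemma exists_isosceles_orthogonal_multiple:
  assumes g: "gauge_fun \<gamma>" and z: "z \<noteq> 0"
  obtains t where "\<bar>t\<bar> < 1" "isosceles_orthogonal \<gamma> (t *\<^sub>R z) z"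
proof -
  define A B where "A = \<gamma> z" and "B = \<gamma> (- z)"
  have AB: "A > 0" "B > 0" using gauge_pos[OF g] z by (auto simp: A_def B_def)
  \<comment> \<open>The solution of (1 + t) A = (1 - t) B, of modulus below 1 because
    \<open>A\<close> and \<open>B\<close> are positive.\<close>
  define t where "t = (B - A) / (A + B)"
  have t: "1 + t = 2 * B / (A + B)" "1 - t = 2 * A / (A + B)"
    using AB by (simp_all add: t_def field_simps)
  moreover have "\<bar>t\<bar> < 1" using AB by (auto simp: t_def abs_if field_simps)
  ultimately show thesis
    using that isosceles_orthogonal_multiple_iff[OF g, of t z] by (simp add: A_def B_def)
qed

text \<open>If the orthogonal multiple \<open>t z\<close> had \<open>t\<close> nonzero, some natural
  multiple \<open>r z\<close> of it would have modulus of \<open>r\<close> above 1. Then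
  \<open>r z + z\<close> and \<open>r z - z\<close> are different positive multiples of the same
  vector, so their gauges differ.\<close>

lemma left_natural_multiples_imp_symmetric:
  assumes g: "gauge_fun \<gamma>"
    and mult: "\<And>x z n. isosceles_orthogonal \<gamma> x z \<Longrightarrow> isosceles_orthogonal \<gamma> (real (Suc n) *\<^sub>R x) z"
  shows "\<gamma> (- z) = \<gamma> z"
proof (cases "z = 0")
  case False
  have sc: "\<gamma> (c *\<^sub>R x) = c * \<gamma> x" if "c > 0" for c x
    using g that unfolding gauge_fun_def by blast
  obtain t where t: "\<bar>t\<bar> < 1" and o: "isosceles_orthogonal \<gamma> (t *\<^sub>R z) z"
    using exists_isosceles_orthogonal_multiple[OF g False] .
  have "t = 0"
  proof (rule ccontr)
    assume "t \<noteq> 0"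
    obtain n where "real n > 1 / \<bar>t\<bar>" using reals_Archimedean2 by blast
    then have n: "real (Suc n) > 1 / \<bar>t\<bar>" by simp
    define r where "r = real (Suc n) * t"
    have r: "\<bar>r\<bar> > 1" using n \<open>t \<noteq> 0\<close> unfolding r_def abs_mult by (simp add: field_simps)
    have eq: "\<gamma> (r *\<^sub>R z + z) = \<gamma> (r *\<^sub>R z - z)"
      using mult[OF o, of n] by (simp only: isosceles_orthogonal_def r_def scaleR_scaleR)
    show False
    proof (cases "r > 0")
      case True
      have "r *\<^sub>R z + z = (r + 1) *\<^sub>R z" "r *\<^sub>R z - z = (r - 1) *\<^sub>R z"
        by (simp_all add: algebra_simps)
      then have "(r + 1) * \<gamma> z = (r - 1) * \<gamma> z" using eq r True by (simp add: sc)
      then show False using gauge_pos[OF g False] by simp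
    next
      case r0: False
      have "r *\<^sub>R z + z = (- r - 1) *\<^sub>R (- z)" "r *\<^sub>R z - z = (- r + 1) *\<^sub>R (- z)"
        by (simp_all add: algebra_simps)
      moreover have "- r - 1 > 0" "- r + 1 > 0" using r r0 by auto
      ultimately have "(- r - 1) * \<gamma> (- z) = (- r + 1) * \<gamma> (- z)"
        using eq by (simp only: sc)
      then show False using gauge_pos[OF g, of "- z"] False by simp
    qed
  qed
  then show ?thesis using o isosceles_orthogonal_multiple_iff[OF g, of 0 z] by simp
qed simp

section \<open>From each condition on orthogonality to an inner product\<close>

lemma norm_inducedI:
  assumes g: "gauge_fun \<gamma>" and sym: "\<And>x. \<gamma> (- x) = \<gamma> x"
    and hom: "\<And>x y c. isosceles_orthogonal \<gamma> x y \<Longrightarrow> c > 0 \<Longrightarrow> isosceles_orthogonal \<gamma> x (c *\<^sub>R y)"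
  shows "norm_induced_by_inner_product \<gamma>"
proof -
  \<comment> \<open>Symmetry turns positive homogeneity into absolute homogeneity.\<close>
  interpret homogeneous_isosceles_norm \<gamma>
  proof
    show "\<gamma> (c *\<^sub>R x) = \<bar>c\<bar> * \<gamma> x" for c x
    proof -
      have sc: "\<gamma> (c *\<^sub>R x) = c * \<gamma> x" if "c > 0" for c x
        using g that unfolding gauge_fun_def by blast
      consider "c > 0" | "c = 0" | "- c > 0" by linarith
      then show ?thesis
      proof cases
        case 3
        then show ?thesis using sc[OF 3, of x] sym[of "c *\<^sub>R x"] by simp
      qed (auto simp: sc gauge_zero[OF g])
    qed
    show "x = 0" if "\<gamma> x = 0" for x
      using g that unfolding gauge_fun_def by blast
    show "0 \<le> \<gamma> x" for x
      using g unfolding gauge_fun_def by blast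
    show "continuous_on UNIV \<gamma>" by (rule gauge_continuous[OF g])
    show "\<gamma> (x + c *\<^sub>R y) = \<gamma> (x - c *\<^sub>R y)" if "\<gamma> (x + y) = \<gamma> (x - y)" "c > 0" for x y c
      using hom that unfolding isosceles_orthogonal_def by blast
  qed
  have "inner_product polar"
    unfolding inner_product_def using polar_bilinear polar_commute polar_pos by blast
  moreover have "\<gamma> x = sqrt (polar x x)" for x
    using nonneg by (simp add: polar_self)
  ultimately show ?thesis unfolding norm_induced_by_inner_product_def by blast
qed

text \<open>This trades a factor \<open>c\<close> on one side for the factor \<open>1 / c\<close> on
  the other.\<close>

lemma isosceles_orthogonal_scaled:
  assumes "gauge_fun \<gamma>" "c > 0"
  shows "isosceles_orthogonal \<gamma> (c *\<^sub>R x) (c *\<^sub>R y) \<longleftrightarrow> isosceles_orthogonal \<gamma> x y"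
proof -
  have "\<gamma> (c *\<^sub>R z) = c * \<gamma> z" for z
    using assms unfolding gauge_fun_def by blast
  then show ?thesis
    using assms(2) by (simp add: isosceles_orthogonal_def flip: scaleR_add_right scaleR_diff_right)
qed

lemma isosceles_orthogonal_commute:
  assumes "\<And>x. \<gamma> (- x) = \<gamma> x"
  shows "isosceles_orthogonal \<gamma> x y \<longleftrightarrow> isosceles_orthogonal \<gamma> y x"
  using assms[of "x - y"] by (simp add: isosceles_orthogonal_def add.commute)

lemma left_homogeneous_imp_norm_induced:
  assumes g: "gauge_fun \<gamma>"
    and hom: "\<And>x y c. isosceles_orthogonal \<gamma> x y \<Longrightarrow> c > 0 \<Longrightarrow> isosceles_orthogonal \<gamma> (c *\<^sub>R x) y"
  shows "norm_induced_by_inner_product \<gamma>"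
proof (rule norm_inducedI[OF g])
  show "\<gamma> (- x) = \<gamma> x" for x
    by (rule left_natural_multiples_imp_symmetric[OF g hom]) auto
  show "isosceles_orthogonal \<gamma> x (c *\<^sub>R y)" if "isosceles_orthogonal \<gamma> x y" "c > 0" for x y c
    using hom[OF that(1), of "1 / c"] isosceles_orthogonal_scaled[OF g that(2), of "(1 / c) *\<^sub>R x" y]
      that(2) by simp
qed

lemma right_homogeneous_imp_left_homogeneous:
  assumes g: "gauge_fun \<gamma>"
    and hom: "\<And>x y c. isosceles_orthogonal \<gamma> x y \<Longrightarrow> c > 0 \<Longrightarrow> isosceles_orthogonal \<gamma> x (c *\<^sub>R y)"
    and o: "isosceles_orthogonal \<gamma> x y" and c: "c > 0"
  shows "isosceles_orthogonal \<gamma> (c *\<^sub>R x) y"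
  using hom[OF o, of "1 / c"] isosceles_orthogonal_scaled[OF g c, of x "(1 / c) *\<^sub>R y"] c by simp

text \<open>Symmetry of the gauge makes orthogonality symmetric, so natural multiples are available
  on both sides; they give positive rational factors, and continuity gives the real ones.\<close>

lemma left_natural_multiples_imp_norm_induced:
  assumes g: "gauge_fun \<gamma>"
    and sym: "\<And>x. \<gamma> (- x) = \<gamma> x"
    and mult: "\<And>x z n. isosceles_orthogonal \<gamma> x z \<Longrightarrow> isosceles_orthogonal \<gamma> (real (Suc n) *\<^sub>R x) z"
  shows "norm_induced_by_inner_product \<gamma>"
proof (rule left_homogeneous_imp_norm_induced[OF g])
  fix x y :: "real ^ 'a" and c :: real
  assume o: "isosceles_orthogonal \<gamma> x y" and c: "c > 0"
  have rat: "isosceles_orthogonal \<gamma> (q *\<^sub>R x) y" if "q \<in> \<rat>" "q > 0" for q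
  proof -
    obtain m n where n: "n \<noteq> 0" and q: "\<bar>q\<bar> = real m / real n"
      using Rats_abs_nat_div_natE[OF \<open>q \<in> \<rat>\<close>] by blast
    have "m \<noteq> 0"
    proof
      assume "m = 0"
      then show False using q \<open>q > 0\<close> by simp
    qed
    then obtain m' n' where S: "m = Suc m'" "n = Suc n'" using n by (cases m; cases n) auto
    note comm = isosceles_orthogonal_commute[of \<gamma>, OF sym]
    \<comment> \<open>Multiply \<open>y\<close> by \<open>n\<close> and \<open>x\<close> by
      \<open>m\<close>, then divide both by \<open>n\<close>.\<close>
    have "isosceles_orthogonal \<gamma> y x" using o by (subst comm)
    then have "isosceles_orthogonal \<gamma> (real n *\<^sub>R y) x" unfolding S by (rule mult)
    then have "isosceles_orthogonal \<gamma> x (real n *\<^sub>R y)" by (subst comm)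
    then have "isosceles_orthogonal \<gamma> (real m *\<^sub>R x) (real n *\<^sub>R y)" unfolding S by (rule mult)
    moreover have "real m *\<^sub>R x = real n *\<^sub>R (q *\<^sub>R x)" using n q \<open>q > 0\<close> by simp
    ultimately show ?thesis
      using isosceles_orthogonal_scaled[OF g, of "real n" "q *\<^sub>R x" y] n by simp
  qed
  \<comment> \<open>Approximating \<open>c\<close> from above keeps the rationals positive.\<close>
  have "\<exists>q. q \<in> \<rat> \<and> c < q \<and> q < c + 1 / real (Suc n)" for n
    using Rats_dense_in_real[of c "c + 1 / real (Suc n)"] by auto
  then have "\<exists>q. \<forall>n. q n \<in> \<rat> \<and> c < q n \<and> q n < c + 1 / real (Suc n)"
    by (intro choice allI)
  then obtain q where q: "\<And>n. q n \<in> \<rat>" "\<And>n. c < q n" "\<And>n. q n < c + 1 / real (Suc n)"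
    by blast
  have lim: "q \<longlonglongrightarrow> c"
  proof (rule tendsto_sandwich[where f = "\<lambda>_. c"])
    show "(\<lambda>n. c + 1 / real (Suc n)) \<longlonglongrightarrow> c"
      using tendsto_add[OF tendsto_const LIMSEQ_inverse_real_of_nat, of c]
      by (simp add: inverse_eq_divide)
  qed (use q in \<open>auto intro!: always_eventually less_imp_le\<close>)
  have ct: "isCont \<gamma> z" for z
    using gauge_continuous[OF g] by (simp add: continuous_on_eq_continuous_at)
  have "(\<lambda>n. \<gamma> (q n *\<^sub>R x + y)) \<longlonglongrightarrow> \<gamma> (c *\<^sub>R x + y)"
    "(\<lambda>n. \<gamma> (q n *\<^sub>R x - y)) \<longlonglongrightarrow> \<gamma> (c *\<^sub>R x - y)"
    by (intro isCont_tendsto_compose[OF ct] tendsto_intros lim)+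
  moreover have "\<gamma> (q n *\<^sub>R x + y) = \<gamma> (q n *\<^sub>R x - y)" for n
    using rat[OF q(1)[of n]] q(2)[of n] c by (simp add: isosceles_orthogonal_def)
  ultimately show "isosceles_orthogonal \<gamma> (c *\<^sub>R x) y"
    unfolding isosceles_orthogonal_def by (simp only: LIMSEQ_unique)
qed

text \<open>Repeatedly adding \<open>x\<close> yields its positive natural multiples, which give
  first symmetry and then the inner product.\<close>

lemma left_additive_imp_norm_induced:
  assumes g: "gauge_fun \<gamma>"
    and add: "\<And>x y z. isosceles_orthogonal \<gamma> x z \<Longrightarrow> isosceles_orthogonal \<gamma> y z
      \<Longrightarrow> isosceles_orthogonal \<gamma> (x + y) z"
  shows "norm_induced_by_inner_product \<gamma>"
proof -
  have mult: "isosceles_orthogonal \<gamma> (real (Suc n) *\<^sub>R x) z" if "isosceles_orthogonal \<gamma> x z" for n x z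
  proof (induction n)
    case (Suc n)
    have "real (Suc (Suc n)) *\<^sub>R x = real (Suc n) *\<^sub>R x + 1 *\<^sub>R x"
      unfolding scaleR_add_left[symmetric] by simp
    then show ?case using add[OF Suc that] by simp
  qed (use that in simp)
  then show ?thesis
    by (intro left_natural_multiples_imp_norm_induced left_natural_multiples_imp_symmetric g)
qed

text \<open>Doubling \<open>z\<close> on the right and scaling both sides by 1/2 shows that
  \<open>t / 2\<close> satisfies the same linear relation as \<open>t\<close>; the two relations
  together force symmetry.\<close>

lemma right_additive_imp_symmetric:
  assumes g: "gauge_fun \<gamma>"
    and add: "\<And>x y z. isosceles_orthogonal \<gamma> x y \<Longrightarrow> isosceles_orthogonal \<gamma> x z
      \<Longrightarrow> isosceles_orthogonal \<gamma> x (y + z)"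
  shows "\<gamma> (- z) = \<gamma> z"
proof (cases "z = 0")
  case False
  obtain t where t: "\<bar>t\<bar> < 1" and o: "isosceles_orthogonal \<gamma> (t *\<^sub>R z) z"
    using exists_isosceles_orthogonal_multiple[OF g False] .
  have "isosceles_orthogonal \<gamma> ((t / 2) *\<^sub>R z) z"
    using add[OF o o] isosceles_orthogonal_scaled[OF g, of 2 "(t / 2) *\<^sub>R z" z]
    by (simp flip: scaleR_2)
  then have half: "(1 + t / 2) * \<gamma> z = (1 - t / 2) * \<gamma> (- z)"
    using isosceles_orthogonal_multiple_iff[OF g, of "t / 2" z] t by simp
  have full: "(1 + t) * \<gamma> z = (1 - t) * \<gamma> (- z)"
    using isosceles_orthogonal_multiple_iff[OF g t] o by blast
  \<comment> \<open>By \<open>half\<close> and \<open>full\<close> only the last term survives, so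
    the left side equals its own double.\<close>
  have "\<gamma> (- z) - \<gamma> z = 2 * ((1 + t / 2) * \<gamma> z - (1 - t / 2) * \<gamma> (- z))
      - ((1 + t) * \<gamma> z - (1 - t) * \<gamma> (- z)) + 2 * (\<gamma> (- z) - \<gamma> z)"
    by (simp add: algebra_simps)
  then show ?thesis using half full by simp
qed simp

section \<open>Orthogonality for an inner product, and the equivalence\<close>

lemma norm_induced_orthogonal_iff:
  assumes "inner_product B" "\<And>x. \<gamma> x = sqrt (B x x)"
  shows "isosceles_orthogonal \<gamma> x y \<longleftrightarrow> B x y = 0"
proof -
  have b: "bilinear B" and s: "B y x = B x y" for x y
    using assms(1) by (auto simp: inner_product_def)
  \<comment> \<open>The roots agree exactly if the radicands do, and these differ by
    \<open>4 * B x y\<close>.\<close>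
  show ?thesis
    by (auto simp: isosceles_orthogonal_def assms(2) s bilinear_ladd[OF b] bilinear_radd[OF b]
        bilinear_lsub[OF b] bilinear_rsub[OF b])
qed

theorem theorem4p9:
  fixes \<gamma> :: "real ^ 'd \<Rightarrow> real"
  assumes "gauge_fun \<gamma>"
  shows
    "(norm_induced_by_inner_product \<gamma> \<longleftrightarrow>
       (\<forall>x y. \<forall>c>0. isosceles_orthogonal \<gamma> x y \<longrightarrow> isosceles_orthogonal \<gamma> x (c *\<^sub>R y))) \<and>
     (norm_induced_by_inner_product \<gamma> \<longleftrightarrow>
       (\<forall>x y z. isosceles_orthogonal \<gamma> x y \<and> isosceles_orthogonal \<gamma> x z \<longrightarrow>
          isosceles_orthogonal \<gamma> x (y + z))) \<and>
     (norm_induced_by_inner_product \<gamma> \<longleftrightarrow>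
       (\<forall>x y. \<forall>c>0. isosceles_orthogonal \<gamma> x y \<longrightarrow> isosceles_orthogonal \<gamma> (c *\<^sub>R x) y)) \<and>
     (norm_induced_by_inner_product \<gamma> \<longleftrightarrow>
       (\<forall>x y z. isosceles_orthogonal \<gamma> x z \<and> isosceles_orthogonal \<gamma> y z \<longrightarrow>
          isosceles_orthogonal \<gamma> (x + y) z))"
proof -
  have forward: "isosceles_orthogonal \<gamma> x y \<longrightarrow> isosceles_orthogonal \<gamma> x (c *\<^sub>R y)"
    "isosceles_orthogonal \<gamma> x y \<and> isosceles_orthogonal \<gamma> x z \<longrightarrow> isosceles_orthogonal \<gamma> x (y + z)"
    "isosceles_orthogonal \<gamma> x y \<longrightarrow> isosceles_orthogonal \<gamma> (c *\<^sub>R x) y"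
    "isosceles_orthogonal \<gamma> x z \<and> isosceles_orthogonal \<gamma> y z \<longrightarrow> isosceles_orthogonal \<gamma> (x + y) z"
    if ind: "norm_induced_by_inner_product \<gamma>" for x y z c
  proof -
    obtain B where B: "inner_product B" "\<And>x. \<gamma> x = sqrt (B x x)"
      using ind unfolding norm_induced_by_inner_product_def by blast
    then have b: "bilinear B" by (simp add: inner_product_def)
    note o = norm_induced_orthogonal_iff[OF B]
    show "isosceles_orthogonal \<gamma> x y \<longrightarrow> isosceles_orthogonal \<gamma> x (c *\<^sub>R y)"
      "isosceles_orthogonal \<gamma> x y \<and> isosceles_orthogonal \<gamma> x z \<longrightarrow> isosceles_orthogonal \<gamma> x (y + z)"
      "isosceles_orthogonal \<gamma> x y \<longrightarrow> isosceles_orthogonal \<gamma> (c *\<^sub>R x) y"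
      "isosceles_orthogonal \<gamma> x z \<and> isosceles_orthogonal \<gamma> y z \<longrightarrow> isosceles_orthogonal \<gamma> (x + y) z"
      by (simp_all add: o bilinear_ladd[OF b] bilinear_radd[OF b] bilinear_lmul[OF b]
          bilinear_rmul[OF b])
  qed
  have d: "norm_induced_by_inner_product \<gamma>"
    if "\<forall>x y. \<forall>c>0. isosceles_orthogonal \<gamma> x y \<longrightarrow> isosceles_orthogonal \<gamma> (c *\<^sub>R x) y"
    using left_homogeneous_imp_norm_induced[OF assms] that by blast
  have b: "norm_induced_by_inner_product \<gamma>"
    if "\<forall>x y. \<forall>c>0. isosceles_orthogonal \<gamma> x y \<longrightarrow> isosceles_orthogonal \<gamma> x (c *\<^sub>R y)"
    using d right_homogeneous_imp_left_homogeneous[OF assms] that by blast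
  have e: "norm_induced_by_inner_product \<gamma>"
    if "\<forall>x y z. isosceles_orthogonal \<gamma> x z \<and> isosceles_orthogonal \<gamma> y z \<longrightarrow>
      isosceles_orthogonal \<gamma> (x + y) z"
    using left_additive_imp_norm_induced[OF assms] that by blast
  have c: "norm_induced_by_inner_product \<gamma>"
    if add: "\<forall>x y z. isosceles_orthogonal \<gamma> x y \<and> isosceles_orthogonal \<gamma> x z \<longrightarrow>
      isosceles_orthogonal \<gamma> x (y + z)"
  proof -
    \<comment> \<open>Once the gauge is symmetric, right and left additivity coincide.\<close>
    have "\<gamma> (- z) = \<gamma> z" for z
      using right_additive_imp_symmetric[OF assms] add by blast
    then show ?thesis
      using e add isosceles_orthogonal_commute[of \<gamma>] by blast
  qed
  show ?thesis
    using forward b c d e by (intro conjI iffI) blast+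
qed

end
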